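(* Let $\mathbb{P}$ be an $r$-rectangular uncertainty set whose factor sets $\mathcal{W}^1,\dots,\mathcal{W}^r$ satisfy the tractability assumption stated in the context. Then there exists a stationary policy that is a solution to the policy improvement problem $$\max_{\pi\in\Pi^G}\min_{P\in\mathbb{P}}R(\pi,P).$$
   Context: MDP setting: finite state set $\mathcal{S}$, $|\mathcal{S}|=S$; finite action set $\mathcal{A}$, $|\mathcal{A}|=A$; rewards $r_{sa}\ge0$; discount factor $\lambda\in(0,1)$; initial probability distribution $p_0$ on $\mathcal{S}$. $\Pi^G$ is the set of all policies: for each period $t$ a policy maps histories $(s_0,a_0,\dots,s_t)$ to probability distributions on $\mathcal{A}$. A policy is stationary if this distribution depends only on the current state (not on $t$ or the past). For a transition kernel $P$, $R(\pi,P)=\mathbb{E}^{\pi,P}\big[\sum_{t\ge0}\lambda^t r_{s_ta_t}\mid s_0\sim p_0\big]$. $r$-rectangular uncertainty set: fix an integer $r\ge1$, coefficients $u^i_{sa}\ge0$ with $\sum_{i=1}^r u^i_{sa}=1$ for all $(s,a)$, and sets $\mathcal{W}^1,\dots,\mathcal{W}^r$ of probability vectors in $\mathbb{R}^S_+$; put $\mathcal{W}=\mathcal{W}^1\times\dots\times\mathcal{W}^r$. Each $W=(w_1,\dots,w_r)\in\mathcal{W}$ determines the kernel $P_{sas'}=\sum_{i=1}^r u^i_{sa}w_{i,s'}$, and $\mathbb{P}$ is the set of all these kernels. Tractability assumption: the $\mathcal{W}^i$ are (nonempty) convex compact and, for any $i$ and any cost vector $c\in\mathbb{R}^S$, an $\epsilon$-optimal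 solution of $\min_{w_i\in\mathcal{W}^i}c^\top w_i$ can be found in $O(comp(\mathcal{W}^i)\log(\epsilon^{-1}))$ arithmetic operations, where $comp(\mathcal{W}^i)\in\mathbb{R}$ depends only on the structure of $\mathcal{W}^i$. *)

theory Defs
  imports "HOL-Probability.Probability" "HOL-Library.Landau_Symbols"
begin

section \<open>Policies and the discounted return\<close>

text \<open>A policy is given the past state-action pairs \<open>(s\<^sub>0,a\<^sub>0),\<dots>,(s\<^sub>t\<^sub>-\<^sub>1,a\<^sub>t\<^sub>-\<^sub>1)\<close> and the
  current state \<open>s\<^sub>t\<close>. The period \<open>t\<close> is the length of the list, so the policy may depend
  on it, and the set of all policies is the whole type.\<close>

type_synonym ('s, 'a) policy = "('s \<times> 'a) list \<Rightarrow> 's \<Rightarrow> 'a pmf"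

definition stationary :: "('s, 'a) policy \<Rightarrow> bool" where
  "stationary \<pi> \<longleftrightarrow> (\<exists>\<mu>. \<forall>h s. \<pi> h s = \<mu> s)"

text \<open>\<open>P s a $ s'\<close> is the probability of moving from \<open>s\<close> to \<open>s'\<close> under action \<open>a\<close>.\<close>

type_synonym ('s, 'a) kernel = "'s \<Rightarrow> 'a \<Rightarrow> real ^ 's"

definition prob_vector :: "real ^ 's::finite \<Rightarrow> bool" where
  "prob_vector w \<longleftrightarrow> (\<forall>s. 0 \<le> w $ s) \<and> (\<Sum>s\<in>UNIV. w $ s) = 1"

text \<open>Conditional law of \<open>(s\<^sub>t, a\<^sub>t)\<close> given the trajectory \<open>\<omega>\<close> before period \<open>t\<close>.
  Only meaningful when every row of \<open>P\<close> is a probability vector.\<close>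

definition next_pair ::
  "'s::finite pmf \<Rightarrow> ('s, 'a) policy \<Rightarrow> ('s, 'a) kernel \<Rightarrow> nat \<Rightarrow> (nat \<Rightarrow> 's \<times> 'a) \<Rightarrow> ('s \<times> 'a) pmf"
where
  "next_pair p0 \<pi> P t \<omega> =
     bind_pmf
       (case t of 0 \<Rightarrow> p0 | Suc k \<Rightarrow> embed_pmf (\<lambda>s'. P (fst (\<omega> k)) (snd (\<omega> k)) $ s'))
       (\<lambda>s. map_pmf (\<lambda>a. (s, a)) (\<pi> (map \<omega> [0..<t]) s))"

text \<open>The law of the infinite trajectory \<open>(s\<^sub>0,a\<^sub>0),(s\<^sub>1,a\<^sub>1),\<dots>\<close>, by the Ionescu-Tulcea
  construction.\<close>

definition trajectory_measure ::
  "'s::finite pmf \<Rightarrow> ('s, 'a::finite) policy \<Rightarrow> ('s, 'a) kernel \<Rightarrow> (nat \<Rightarrow> 's \<times> 'a) measure"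
where
  "trajectory_measure p0 \<pi> P =
     projective_family.lim UNIV
       (Ionescu_Tulcea.CI (\<lambda>t \<omega>. measure_pmf (next_pair p0 \<pi> P t \<omega>)) (\<lambda>_. count_space UNIV))
       (\<lambda>_. count_space UNIV)"

definition expected_return ::
  "('s::finite \<Rightarrow> 'a::finite \<Rightarrow> real) \<Rightarrow> real \<Rightarrow> 's pmf \<Rightarrow> ('s, 'a) policy \<Rightarrow> ('s, 'a) kernel \<Rightarrow> real"
where
  "expected_return rew l p0 \<pi> P =
     (\<integral>\<omega>. (\<Sum>t. l ^ t * rew (fst (\<omega> t)) (snd (\<omega> t))) \<partial>trajectory_measure p0 \<pi> P)"

section \<open>Rectangular uncertainty and policy improvement\<close>

text \<open>The factors are indexed by a finite type \<open>'r\<close>, so the number of factors is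
  \<open>CARD('r) \<ge> 1\<close>.\<close>

definition r_rectangular_data ::
  "('r::finite \<Rightarrow> 's::finite \<Rightarrow> 'a::finite \<Rightarrow> real) \<Rightarrow> ('r \<Rightarrow> (real ^ 's) set) \<Rightarrow> bool"
where
  "r_rectangular_data u W \<longleftrightarrow>
     (\<forall>i s a. 0 \<le> u i s a) \<and> (\<forall>s a. (\<Sum>i\<in>UNIV. u i s a) = 1) \<and>
     (\<forall>i. \<forall>w\<in>W i. prob_vector w)"

definition uncertainty_set ::
  "('r::finite \<Rightarrow> 's::finite \<Rightarrow> 'a::finite \<Rightarrow> real) \<Rightarrow> ('r \<Rightarrow> (real ^ 's) set) \<Rightarrow> ('s, 'a) kernel set"
where
  "uncertainty_set u W =
     {(\<lambda>s a. \<chi> s'. \<Sum>i\<in>UNIV. u i s a * w i $ s') | w. \<forall>i. w i \<in> W i}"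

text \<open>\<open>\<pi>\<close> solves \<open>max\<^sub>\<pi> min\<^sub>P R \<pi> P\<close>. Both extrema are genuine: the inner
  minimum has to be attained for every policy.\<close>

definition solves_max_min ::
  "('p \<Rightarrow> 'k \<Rightarrow> real) \<Rightarrow> 'p set \<Rightarrow> 'k set \<Rightarrow> 'p \<Rightarrow> bool"
where
  "solves_max_min R F K \<pi> \<longleftrightarrow> \<pi> \<in> F \<and>
     (\<exists>P. is_arg_min (R \<pi>) (\<lambda>Q. Q \<in> K) P \<and>
       (\<forall>\<pi>'\<in>F. \<exists>P'. is_arg_min (R \<pi>') (\<lambda>Q. Q \<in> K) P' \<and> R \<pi>' P' \<le> R \<pi> P))"

section \<open>Arithmetic operations and tractability\<close>

text \<open>A real-number random access machine. The input is a cost vector and an accuracy,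
  the result is read off the cells \<open>Out s\<close>, and \<open>Tmp\<close> is working memory with indirect
  addressing. Each arithmetic operation and each comparison costs 1, moving data is free.\<close>

datatype 's cell = Cost 's | Accuracy | Out 's | Tmp nat

datatype 's expr =
    Const real
  | Cell "'s cell"
  | Plus "'s expr" "'s expr"
  | Minus "'s expr" "'s expr"
  | Times "'s expr" "'s expr"
  | Divide "'s expr" "'s expr"

type_synonym 's memory = "'s cell \<Rightarrow> real"

primrec expr_val :: "'s memory \<Rightarrow> 's expr \<Rightarrow> real" where
  "expr_val \<sigma> (Const x) = x"
| "expr_val \<sigma> (Cell v) = \<sigma> v"
| "expr_val \<sigma> (Plus e f) = expr_val \<sigma> e + expr_val \<sigma> f"
| "expr_val \<sigma> (Minus e f) = expr_val \<sigma> e - expr_val \<sigma> f"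
| "expr_val \<sigma> (Times e f) = expr_val \<sigma> e * expr_val \<sigma> f"
| "expr_val \<sigma> (Divide e f) = expr_val \<sigma> e / expr_val \<sigma> f"

primrec expr_ops :: "'s expr \<Rightarrow> nat" where
  "expr_ops (Const x) = 0"
| "expr_ops (Cell v) = 0"
| "expr_ops (Plus e f) = Suc (expr_ops e + expr_ops f)"
| "expr_ops (Minus e f) = Suc (expr_ops e + expr_ops f)"
| "expr_ops (Times e f) = Suc (expr_ops e + expr_ops f)"
| "expr_ops (Divide e f) = Suc (expr_ops e + expr_ops f)"

datatype 's program =
    Skip
  | Assign "'s cell" "'s expr"
  | Load "'s cell" "'s cell"
  | Store "'s cell" "'s cell"
  | Seq "'s program" "'s program"
  | IfLess "'s expr" "'s expr" "'s program" "'s program"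
  | WhileLess "'s expr" "'s expr" "'s program"

text \<open>\<open>runs p \<sigma> n \<tau>\<close>: started in memory \<open>\<sigma>\<close>, the program \<open>p\<close> terminates in memory \<open>\<tau>\<close>
  after \<open>n\<close> operations. An indirect access is stuck unless the address is a natural number.\<close>

inductive runs :: "'s program \<Rightarrow> 's memory \<Rightarrow> nat \<Rightarrow> 's memory \<Rightarrow> bool" where
  Skip: "runs Skip \<sigma> 0 \<sigma>"
| Assign: "runs (Assign v e) \<sigma> (expr_ops e) (\<sigma>(v := expr_val \<sigma> e))"
| Load: "\<sigma> x = real k \<Longrightarrow> runs (Load v x) \<sigma> 0 (\<sigma>(v := \<sigma> (Tmp k)))"
| Store: "\<sigma> x = real k \<Longrightarrow> runs (Store x v) \<sigma> 0 (\<sigma>(Tmp k := \<sigma> v))"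
| Seq: "runs p \<sigma> m \<rho> \<Longrightarrow> runs q \<rho> n \<tau> \<Longrightarrow> runs (Seq p q) \<sigma> (m + n) \<tau>"
| IfTrue: "expr_val \<sigma> e < expr_val \<sigma> f \<Longrightarrow> runs p \<sigma> n \<tau> \<Longrightarrow>
    runs (IfLess e f p q) \<sigma> (Suc (expr_ops e + expr_ops f) + n) \<tau>"
| IfFalse: "\<not> expr_val \<sigma> e < expr_val \<sigma> f \<Longrightarrow> runs q \<sigma> n \<tau> \<Longrightarrow>
    runs (IfLess e f p q) \<sigma> (Suc (expr_ops e + expr_ops f) + n) \<tau>"
| WhileTrue: "expr_val \<sigma> e < expr_val \<sigma> f \<Longrightarrow> runs p \<sigma> m \<rho> \<Longrightarrow>
    runs (WhileLess e f p) \<rho> n \<tau> \<Longrightarrow>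
    runs (WhileLess e f p) \<sigma> (Suc (expr_ops e + expr_ops f) + m + n) \<tau>"
| WhileFalse: "\<not> expr_val \<sigma> e < expr_val \<sigma> f \<Longrightarrow>
    runs (WhileLess e f p) \<sigma> (Suc (expr_ops e + expr_ops f)) \<sigma>"

primrec input_memory :: "real ^ 's::finite \<Rightarrow> real \<Rightarrow> 's memory" where
  "input_memory c \<epsilon> (Cost s) = c $ s"
| "input_memory c \<epsilon> Accuracy = \<epsilon>"
| "input_memory c \<epsilon> (Out s) = 0"
| "input_memory c \<epsilon> (Tmp k) = 0"

definition eps_optimal :: "(real ^ 's::finite) set \<Rightarrow> real ^ 's \<Rightarrow> real \<Rightarrow> real ^ 's \<Rightarrow> bool" where
  "eps_optimal W c \<epsilon> w \<longleftrightarrow> w \<in> W \<and> (\<forall>w'\<in>W. c \<bullet> w \<le> c \<bullet> w' + \<epsilon>)"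

text \<open>One program, which may depend on \<open>W\<close>, has to serve all costs and accuracies. The
  asymptotic bound is for \<open>\<epsilon> \<rightarrow> 0\<close>, for each \<open>c\<close>. A constant that is uniform in \<open>c\<close> would be
  a more restrictive assumption. \<open>complexity\<close> sees nothing but the set \<open>W\<close>.\<close>

definition tractable :: "((real ^ 's::finite) set \<Rightarrow> real) \<Rightarrow> (real ^ 's) set \<Rightarrow> bool" where
  "tractable complexity W \<longleftrightarrow>
     W \<noteq> {} \<and> convex W \<and> compact W \<and>
     (\<exists>(p :: 's program) (ops :: real ^ 's \<Rightarrow> real \<Rightarrow> nat).
        (\<forall>c. \<forall>\<epsilon>>0. \<exists>\<tau>. runs p (input_memory c \<epsilon>) (ops c \<epsilon>) \<tau> \<and>
           eps_optimal W c \<epsilon> (\<chi> s. \<tau> (Out s))) \<and>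
        (\<forall>c. (\<lambda>\<epsilon>. real (ops c \<epsilon>)) \<in> O[at_right 0](\<lambda>\<epsilon>. complexity W * ln (inverse \<epsilon>))))"

end

theory Submission
  imports Defs
begin

text \<open>For a value vector \<open>v\<close> the worst case \<open>min w\<^sub>i \<bullet> v\<close> over \<open>w\<^sub>i \<in> W i\<close> depends neither on the
  state nor on the action. Hence the operator
  \<open>v s \<mapsto> max\<^sub>a (rew s a + l * (\<Sum>\<^sub>i u i s a * min w\<^sub>i \<bullet> v))\<close> has a fixed point \<open>v\<close>, and the
  maximising decision rule together with the minimising factors is a saddle point: by the
  performance difference identity, no policy earns more than \<open>p0 \<bullet> v\<close> against the kernel of the
  minimising factors, and the decision rule earns at least \<open>p0 \<bullet> v\<close> against every kernel. The
  inner minimum is attained for every policy because the return is a uniform limit of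
  polynomials in the factors.\<close>

section \<open>Laws of finite histories generated one entry at a time\<close>

primrec history_pmf :: "('x list \<Rightarrow> 'x pmf) \<Rightarrow> nat \<Rightarrow> 'x list pmf" where
  "history_pmf L 0 = return_pmf []"
| "history_pmf L (Suc n) = bind_pmf (history_pmf L n) (\<lambda>h. map_pmf (\<lambda>x. h @ [x]) (L h))"

lemma length_history: "h \<in> set_pmf (history_pmf L n) \<Longrightarrow> length h = n"
  by (induction n arbitrary: h) auto

lemma finite_set_history:
  fixes L :: "'x::finite list \<Rightarrow> 'x pmf"
  shows "finite (set_pmf (history_pmf L n))"
  by (rule finite_subset[OF _ finite_lists_length_eq[of UNIV n]]) (auto dest: length_history)

text \<open>The list \<open>h @ [x]\<close> determines both its prefix and its last entry, so in the
  defining bind only the prefix \<open>h\<close> contributes. Iterating this turns the probability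
  of a history into a product of step probabilities, which is what the continuity argument
  needs.\<close>

lemma pmf_history_snoc:
  "pmf (history_pmf L (Suc (length h))) (h @ [x]) = pmf (history_pmf L (length h)) h * pmf (L h) x"
proof -
  have inj: "inj (\<lambda>x. k @ [x])" for k :: "'a list" by (auto intro: injI)
  have "pmf (map_pmf (\<lambda>x. k @ [x]) (L k)) (h @ [x]) = pmf (L h) x * indicator {h} k" for k
  proof (cases "k = h")
    case True
    then show ?thesis using pmf_map_inj'[OF inj, of h "L h" x] by simp
  next
    case False
    then show ?thesis by (auto simp: pmf_eq_0_set_pmf)
  qed
  then show ?thesis
    by (simp add: pmf_bind measure_pmf_single)
qed

lemma expectation_history_Suc:
  fixes F :: "'x::finite list \<Rightarrow> real"
  shows "measure_pmf.expectation (history_pmf L (Suc n)) F =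
    measure_pmf.expectation (history_pmf L n) (\<lambda>h. measure_pmf.expectation (L h) (\<lambda>x. F (h @ [x])))"
proof -
  have "measure_pmf.expectation (history_pmf L (Suc n)) F =
      (\<Sum>h\<in>set_pmf (history_pmf L n). pmf (history_pmf L n) h *\<^sub>R
        measure_pmf.expectation (map_pmf (\<lambda>x. h @ [x]) (L h)) F)"
    unfolding history_pmf.simps
    by (rule pmf_expectation_bind) (auto simp: finite_set_history)
  also have "\<dots> = measure_pmf.expectation (history_pmf L n)
      (\<lambda>h. measure_pmf.expectation (L h) (\<lambda>x. F (h @ [x])))"
    by (subst (2) integral_measure_pmf[OF finite_set_history[of L n]]) auto
  finally show ?thesis .
qed

section \<open>Prefixes of trajectories in the Ionescu-Tulcea construction\<close>

lemma measurable_map_upt: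
  "(\<lambda>\<omega>::nat \<Rightarrow> 'x::countable. map \<omega> [0..<n])
    \<in> measurable (PiM I (\<lambda>_. count_space UNIV)) (count_space UNIV)" if "{0..<n} \<subseteq> I"
  \<comment> \<open>Lists over a countable type are countable, so preimages of singletons suffice.
    Each is cut out by finitely many coordinate conditions.\<close>
  unfolding measurable_count_space_eq2_countable
proof (intro conjI ballI)
  fix h :: "'x list"
  let ?M = "PiM I (\<lambda>_. count_space UNIV) :: (nat \<Rightarrow> 'x) measure"
  have "(map \<omega> [0..<n] = h) = (length h = n \<and> (\<forall>k\<in>{0..<n}. \<omega> k = h ! k))" for \<omega>
    by (subst list_eq_iff_nth_eq) auto
  then have "(\<lambda>\<omega>. map \<omega> [0..<n]) -` {h} \<inter> space ?M =
    {\<omega> \<in> space ?M. length h = n \<and> (\<forall>k\<in>{0..<n}. \<omega> k = h ! k)}"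
    by blast
  also have "\<dots> \<in> sets ?M"
  proof (intro sets.sets_Collect_conj sets.sets_Collect_const sets.sets_Collect_finite_All)
    fix k assume "k \<in> {0..<n}"
    with that have "(\<lambda>\<omega>. \<omega> k) \<in> measurable ?M (count_space UNIV)"
      by (intro measurable_component_singleton) auto
    then have "(\<lambda>\<omega>. \<omega> k) -` {h ! k} \<inter> space ?M \<in> sets ?M"
      by (rule measurable_sets) simp
    also have "(\<lambda>\<omega>. \<omega> k) -` {h ! k} \<inter> space ?M = {\<omega> \<in> space ?M. \<omega> k = h ! k}" by blast
    finally show "{\<omega> \<in> space ?M. \<omega> k = h ! k} \<in> sets ?M" .
  qed simp
  finally show "(\<lambda>\<omega>. map \<omega> [0..<n]) -` {h} \<inter> space (PiM I (\<lambda>_. count_space UNIV))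
    \<in> sets (PiM I (\<lambda>_. count_space UNIV))" .
qed auto

context
  fixes L :: "'x::countable list \<Rightarrow> 'x pmf"
begin

interpretation IT: Ionescu_Tulcea "\<lambda>n \<omega>. measure_pmf (L (map \<omega> [0..<n]))" "\<lambda>_. count_space UNIV"
proof
  fix n
  show "(\<lambda>\<omega>. measure_pmf (L (map \<omega> [0..<n])))
      \<in> measurable (PiM {0..<n} (\<lambda>_. count_space UNIV)) (subprob_algebra (count_space UNIV))"
    by (rule measurable_compose[OF measurable_map_upt]) (auto intro: measure_pmf_in_subprob_algebra)
qed

text \<open>Induction on \<open>n\<close>: the kernel that adds coordinate \<open>n\<close> depends
  on the past only through its prefix, so it can be applied after pushing forward to lists, where it
  becomes the recursion step of \<open>history_pmf\<close>.\<close>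

lemma distr_C_map_upt:
  "distr (IT.C 0 n (\<lambda>_. undefined)) (count_space UNIV) (\<lambda>\<omega>. map \<omega> [0..<n]) = measure_pmf (history_pmf L n)"
proof (induction n)
  case 0
  show ?case
    by (simp add: distr_return return_pmf.rep_eq space_PiM measurable_def sets_PiM_empty)
next
  case (Suc n)
  let ?N = "\<lambda>n. PiM {0..<n} (\<lambda>_. count_space UNIV) :: (nat \<Rightarrow> 'x) measure"
  let ?K = "\<lambda>h. map_pmf (\<lambda>x. h @ [x]) (L h)"
  have u: "(\<lambda>_. undefined) \<in> space (?N 0)" by (simp add: space_PiM)
  have spC: "space (IT.C 0 n (\<lambda>_. undefined)) = space (?N n)" using IT.space_C[OF u, of n] by simp
  have ne: "space (IT.C 0 n (\<lambda>_. undefined)) \<noteq> {}"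
    using IT.prob_space_C[OF u] by (rule prob_space.not_empty)
  have setC: "sets (IT.C 0 n (\<lambda>_. undefined)) = sets (?N n)" using IT.sets_C[OF u, of n] by simp
  \<comment> \<open>\<open>IT.eP n \<omega>\<close> is the law of \<open>\<omega>(n := x)\<close>
    with \<open>x\<close> drawn from the step kernel. Updating coordinate \<open>n\<close> leaves
    the prefix below \<open>n\<close> alone and appends \<open>x\<close> to it.\<close>
  have step: "distr (IT.eP n \<omega>) (count_space UNIV) (\<lambda>\<omega>. map \<omega> [0..<Suc n]) = ?K (map \<omega> [0..<n])"
    if "\<omega> \<in> space (?N n)" for \<omega>
  proof -
    have "fun_upd \<omega> n \<in> measurable (measure_pmf (L (map \<omega> [0..<n]))) (?N (Suc n))"
      using that by (auto simp: space_PiM PiE_iff extensional_def)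
    then have "distr (IT.eP n \<omega>) (count_space UNIV) (\<lambda>\<omega>. map \<omega> [0..<Suc n]) =
      distr (L (map \<omega> [0..<n])) (count_space UNIV) ((\<lambda>\<omega>. map \<omega> [0..<Suc n]) \<circ> fun_upd \<omega> n)"
      unfolding IT.eP_def by (intro distr_distr measurable_map_upt) auto
    also have "((\<lambda>\<omega>. map \<omega> [0..<Suc n]) \<circ> fun_upd \<omega> n) = (\<lambda>x. map \<omega> [0..<n] @ [x])"
      by (auto simp: fun_eq_iff)
    finally show ?thesis by (simp add: map_pmf_rep_eq)
  qed
  have "distr (IT.C 0 (Suc n) (\<lambda>_. undefined)) (count_space UNIV) (\<lambda>\<omega>. map \<omega> [0..<Suc n]) =
      IT.C 0 n (\<lambda>_. undefined) \<bind> (\<lambda>\<omega>. distr (IT.eP n \<omega>) (count_space UNIV) (\<lambda>\<omega>. map \<omega> [0..<Suc n]))"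
    unfolding IT.C.simps add_0
    using IT.measurable_eP[of n]
    by (intro distr_bind[where K="?N (Suc n)"] ne measurable_map_upt)
       (auto simp: measurable_cong_sets[OF setC refl])
  also have "\<dots> = IT.C 0 n (\<lambda>_. undefined) \<bind> (\<lambda>\<omega>. measure_pmf (?K (map \<omega> [0..<n])))"
    by (intro bind_cong refl) (simp only: spC step simp_thms refl)
  also have "\<dots> = distr (IT.C 0 n (\<lambda>_. undefined)) (count_space UNIV) (\<lambda>\<omega>. map \<omega> [0..<n]) \<bind> (\<lambda>h. measure_pmf (?K h))"
    by (rule bind_distr[symmetric, where K="count_space UNIV"])
      (auto simp: measurable_cong_sets[OF setC refl] ne intro!: measurable_map_upt measure_pmf_in_subprob_algebra)
  also have "\<dots> = measure_pmf (history_pmf L (Suc n))"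
    by (simp add: Suc measure_pmf_bind del: IT.C.simps)
  finally show ?case .
qed

text \<open>The prefix of length \<open>n\<close> factors through restriction to
  \<open>{0..<n}\<close>, and the limit measure has the finite-stage measures as its marginals. This
  reduces the claim to \<open>distr_C_map_upt\<close>.\<close>

lemma distr_Ionescu_Tulcea_lim:
  "distr IT.PF.lim (count_space UNIV) (\<lambda>\<omega>. map \<omega> [0..<n]) = measure_pmf (history_pmf L n)"
proof -
  let ?N = "PiM {0..<n} (\<lambda>_. count_space UNIV) :: (nat \<Rightarrow> 'x) measure"
  let ?f = "\<lambda>\<omega>::nat \<Rightarrow> 'x. map \<omega> [0..<n]" and ?r = "\<lambda>\<omega>::nat \<Rightarrow> 'x. restrict \<omega> {0..<n}"
  have fr: "?f \<circ> ?r = ?f" by (auto simp: fun_eq_iff)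
  \<comment> \<open>The marginal on an index set is taken from the stage given by
    \<open>IT.up_to\<close>. It has to be exactly \<open>n\<close>, also when
    \<open>n = 0\<close>.\<close>
  have up: "IT.up_to {0..<n} = n"
  proof (rule antisym)
    show "IT.up_to {0..<n} \<le> n" by (simp add: IT.up_to_iff)
    show "n \<le> IT.up_to {0..<n}" using IT.up_to_less[of "{0..<n}"] by (cases n) (auto simp: Suc_le_eq)
  qed
  have u: "(\<lambda>_. undefined) \<in> space (PiM {0..<0} (\<lambda>_. count_space UNIV) :: (nat \<Rightarrow> 'x) measure)"
    by (simp add: space_PiM)
  have setC: "sets (IT.C 0 n (\<lambda>_. undefined)) = sets ?N" using IT.sets_C[OF u, of n] by simp
  have f: "?f \<in> measurable ?N (count_space UNIV)" by (rule measurable_map_upt) simp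
  have "distr IT.PF.lim (count_space UNIV) ?f = distr IT.PF.lim (count_space UNIV) (?f \<circ> ?r)"
    by (simp only: fr)
  also have "\<dots> = distr (distr IT.PF.lim ?N ?r) (count_space UNIV) ?f"
    by (rule distr_distr[symmetric, OF f])
      (auto simp: measurable_cong_sets[OF IT.PF.sets_lim refl] intro!: measurable_restrict)
  also have "\<dots> = distr (distr (IT.C 0 n (\<lambda>_. undefined)) ?N ?r) (count_space UNIV) ?f"
    by (simp add: IT.distr_lim IT.CI_def up)
  also have "\<dots> = distr (IT.C 0 n (\<lambda>_. undefined)) (count_space UNIV) (?f \<circ> ?r)"
    by (rule distr_distr[OF f])
      (auto simp: measurable_cong_sets[OF setC refl] intro!: measurable_restrict)
  also have "\<dots> = measure_pmf (history_pmf L n)"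
    by (simp only: fr distr_C_map_upt)
  finally show ?thesis .
qed

lemma sets_Ionescu_Tulcea_lim: "sets IT.PF.lim = sets (PiM UNIV (\<lambda>_. count_space UNIV))"
  by simp

text \<open>Pushing forward preserves total mass, and the law of the empty prefix is a probability
  measure.\<close>

lemma prob_space_Ionescu_Tulcea_lim: "prob_space IT.PF.lim"
  by (rule prob_space_distrD[of "\<lambda>\<omega>. map \<omega> [0..<0]" _ "count_space UNIV"])
    (simp_all only: distr_Ionescu_Tulcea_lim prob_space_measure_pmf
      measurable_cong_sets[OF IT.PF.sets_lim refl] measurable_map_upt[of 0 UNIV] subset_UNIV)

end

section \<open>The expected return as a discounted series of one-period expectations\<close>

definition step_pmf :: "'s::finite pmf \<Rightarrow> ('s, 'a) policy \<Rightarrow> ('s, 'a) kernel \<Rightarrow> ('s \<times> 'a) list \<Rightarrow> ('s \<times> 'a) pmf"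
where "step_pmf p0 \<pi> P h = next_pair p0 \<pi> P (length h) (nth h)"

text \<open>The expectation of \<open>g\<close> at the state-action pair of period \<open>t\<close>.
  Periods count from 0, so this pair is the last entry of a history of length
  \<open>Suc t\<close>.\<close>

definition pair_expectation ::
  "'s::finite pmf \<Rightarrow> ('s, 'a) policy \<Rightarrow> ('s, 'a) kernel \<Rightarrow> nat \<Rightarrow> ('s \<times> 'a \<Rightarrow> real) \<Rightarrow> real"
where
  "pair_expectation p0 \<pi> P t g =
    measure_pmf.expectation (history_pmf (step_pmf p0 \<pi> P) (Suc t)) (\<lambda>h. g (last h))"

text \<open>At period \<open>t\<close> only the coordinates below \<open>t\<close> are read, so the
  trajectory may be replaced by its prefix. This puts the trajectory law into the list-driven form
  treated above.\<close>

lemma next_pair_eq_step_pmf: "next_pair p0 \<pi> P t \<omega> = step_pmf p0 \<pi> P (map \<omega> [0..<t])"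
proof -
  have "map ((!) (map \<omega> [0..<t])) [0..<t] = map \<omega> [0..<t]"
    using map_nth[of "map \<omega> [0..<t]"] by simp
  then show ?thesis
    unfolding step_pmf_def next_pair_def by (cases t) (simp_all del: upt_Suc map_eq_conv)
qed

lemma
  fixes p0 :: "'s::finite pmf" and \<pi> :: "('s, 'a::finite) policy"
  shows prob_space_trajectory: "prob_space (trajectory_measure p0 \<pi> P)"
    and sets_trajectory:
      "sets (trajectory_measure p0 \<pi> P) = sets (PiM UNIV (\<lambda>_. count_space UNIV))"
    and distr_trajectory:
      "distr (trajectory_measure p0 \<pi> P) (count_space UNIV) (\<lambda>\<omega>. map \<omega> [0..<n]) =
        measure_pmf (history_pmf (step_pmf p0 \<pi> P) n)"
  unfolding trajectory_measure_def next_pair_eq_step_pmf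
  by (rule prob_space_Ionescu_Tulcea_lim sets_Ionescu_Tulcea_lim distr_Ionescu_Tulcea_lim)+

lemma abs_le_Max:
  fixes g :: "'x::finite \<Rightarrow> real"
  shows "\<bar>g x\<bar> \<le> (MAX x. \<bar>g x\<bar>)"
  by (rule Max_ge) auto

lemma integrable_history:
  fixes L :: "'x::finite list \<Rightarrow> 'x pmf" and F :: "'x list \<Rightarrow> real"
  shows "integrable (measure_pmf (history_pmf L n)) F"
  by (rule integrable_measure_pmf_finite[OF finite_set_history])

lemma abs_pair_expectation_le:
  fixes g :: "'s::finite \<times> 'a::finite \<Rightarrow> real"
  shows "\<bar>pair_expectation p0 \<pi> P t g\<bar> \<le> (MAX x. \<bar>g x\<bar>)"
proof -
  let ?H = "history_pmf (step_pmf p0 \<pi> P) (Suc t)"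
  have "\<bar>measure_pmf.expectation ?H (\<lambda>h. g (last h))\<bar> \<le>
      measure_pmf.expectation ?H (\<lambda>h. \<bar>g (last h)\<bar>)"
    by (rule integral_abs_bound)
  also have "\<dots> \<le> measure_pmf.expectation ?H (\<lambda>h. MAX x. \<bar>g x\<bar>)"
    by (rule integral_mono) (simp_all only: integrable_history abs_le_Max)
  finally show ?thesis by (simp add: pair_expectation_def del: history_pmf.simps)
qed

lemma summable_discounted_pair_expectation:
  fixes g :: "'s::finite \<times> 'a::finite \<Rightarrow> real"
  assumes "0 < l" "l < 1"
  shows "summable (\<lambda>t. l ^ t * pair_expectation p0 \<pi> P t g)"
proof (rule summable_comparison_test')
  show "summable (\<lambda>t. l ^ t * (MAX x. \<bar>g x\<bar>))"
    using assms by (intro summable_mult2 summable_geometric) auto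
  show "norm (l ^ t * pair_expectation p0 \<pi> P t g) \<le> l ^ t * (MAX x. \<bar>g x\<bar>)" for t
    using assms abs_pair_expectation_le[of p0 \<pi> P t g] by (simp add: abs_mult)
qed

text \<open>Rewards are bounded on the finite set of pairs, so a geometric series dominates and
  integral and sum can be exchanged. Each summand then depends on a finite prefix only.\<close>

lemma expected_return_eq_suminf:
  fixes rew :: "'s::finite \<Rightarrow> 'a::finite \<Rightarrow> real"
  assumes "0 < l" "l < 1"
  shows "expected_return rew l p0 \<pi> P =
    (\<Sum>t. l ^ t * pair_expectation p0 \<pi> P t (\<lambda>(s, a). rew s a))"
proof -
  let ?M = "trajectory_measure p0 \<pi> P"
  let ?g = "\<lambda>(s, a). rew s a"
  interpret prob_space ?M by (rule prob_space_trajectory)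
  define B where "B = (MAX x. \<bar>?g x\<bar>)"
  have bound: "\<bar>rew s a\<bar> \<le> B" for s a
    unfolding B_def using abs_le_Max[of ?g "(s, a)"] by simp
  have meas: "(\<lambda>\<omega>. \<omega> t) \<in> measurable ?M (count_space UNIV)" for t
    by (simp add: measurable_cong_sets[OF sets_trajectory refl] measurable_component_singleton)
  have meas_map: "(\<lambda>\<omega>. map \<omega> [0..<n]) \<in> measurable ?M (count_space UNIV)" for n
    by (simp add: measurable_cong_sets[OF sets_trajectory refl] measurable_map_upt)
  have meas_rew: "(\<lambda>\<omega>. l ^ t * rew (fst (\<omega> t)) (snd (\<omega> t))) \<in> borel_measurable ?M" for t
    using measurable_compose[OF meas[of t], of "\<lambda>x. l ^ t * rew (fst x) (snd x)" borel] by simp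
  have le: "norm (l ^ t * rew (fst x) (snd x)) \<le> l ^ t * B" for t x
    using assms bound by (simp add: abs_mult)
  have geo: "summable (\<lambda>t. l ^ t * B)"
    using assms by (intro summable_mult2 summable_geometric) auto
  have int: "integrable ?M (\<lambda>\<omega>. l ^ t * rew (fst (\<omega> t)) (snd (\<omega> t)))" for t
    by (rule integrable_const_bound[where B = "l ^ t * B"]) (use meas_rew le in auto)
  have sum: "expected_return rew l p0 \<pi> P =
      (\<Sum>t. \<integral>\<omega>. l ^ t * rew (fst (\<omega> t)) (snd (\<omega> t)) \<partial>?M)"
    unfolding expected_return_def
  proof (rule integral_suminf[OF int])
    show "AE \<omega> in ?M. summable (\<lambda>t. norm (l ^ t * rew (fst (\<omega> t)) (snd (\<omega> t))))"
      using le by (intro AE_I2 summable_comparison_test'[OF geo]) simp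
    have "norm (\<integral>\<omega>. norm (l ^ t * rew (fst (\<omega> t)) (snd (\<omega> t))) \<partial>?M) \<le> l ^ t * B" for t
    proof -
      have "(\<integral>\<omega>. norm (l ^ t * rew (fst (\<omega> t)) (snd (\<omega> t))) \<partial>?M) \<le> (\<integral>\<omega>. l ^ t * B \<partial>?M)"
        by (rule integral_mono) (use int le in auto)
      then show ?thesis by (simp add: prob_space)
    qed
    then show "summable (\<lambda>t. \<integral>\<omega>. norm (l ^ t * rew (fst (\<omega> t)) (snd (\<omega> t))) \<partial>?M)"
      by (intro summable_comparison_test'[OF geo])
  qed
  have "(\<integral>\<omega>. l ^ t * rew (fst (\<omega> t)) (snd (\<omega> t)) \<partial>?M) = l ^ t * pair_expectation p0 \<pi> P t ?g" for t
  proof -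
    have "pair_expectation p0 \<pi> P t ?g = (\<integral>\<omega>. ?g (last (map \<omega> [0..<Suc t])) \<partial>?M)"
      unfolding pair_expectation_def distr_trajectory[symmetric]
      by (rule integral_distr[OF meas_map]) simp
    then show ?thesis by (simp add: split_beta)
  qed
  with sum show ?thesis by (simp only:)
qed

section \<open>Bellman residuals and the performance difference identity\<close>

lemma pmf_kernel_row:
  fixes P :: "('s::finite, 'a) kernel"
  assumes "prob_vector (P s a)"
  shows "pmf (embed_pmf (\<lambda>s'. P s a $ s')) s' = P s a $ s'"
  using assms
  by (intro pmf_embed_pmf) (auto simp: prob_vector_def nn_integral_count_space_finite sum_ennreal)

lemma step_pmf_Nil: "step_pmf p0 \<pi> P [] = bind_pmf p0 (\<lambda>s. map_pmf (Pair s) (\<pi> [] s))"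
  by (simp add: step_pmf_def next_pair_def)

lemma step_pmf_snoc:
  "step_pmf p0 \<pi> P (h @ [x]) =
    bind_pmf (embed_pmf (\<lambda>s'. P (fst x) (snd x) $ s')) (\<lambda>s. map_pmf (Pair s) (\<pi> (h @ [x]) s))"
proof -
  have "map ((!) (h @ [x])) [0..<Suc (length h)] = h @ [x]"
    using map_nth[of "h @ [x]"] by simp
  then show ?thesis
    by (simp add: step_pmf_def next_pair_def del: upt_Suc)
qed

lemma expectation_state_component:
  fixes q :: "'s::finite pmf" and V :: "'s \<Rightarrow> real"
  shows "measure_pmf.expectation (bind_pmf q (\<lambda>s. map_pmf (Pair s) (k s))) (\<lambda>x. V (fst x)) =
    (\<Sum>s\<in>UNIV. pmf q s * V s)"
proof -
  have "measure_pmf.expectation (map_pmf fst (bind_pmf q (\<lambda>s. map_pmf (Pair s) (k s)))) V =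
      measure_pmf.expectation q V"
    by (simp add: map_bind_pmf pmf.map_comp o_def bind_return_pmf')
  then show ?thesis
    by (simp add: integral_measure_pmf[of UNIV])
qed

lemma pair_expectation_0_state:
  fixes p0 :: "'s::finite pmf" and \<pi> :: "('s, 'a::finite) policy"
  shows "pair_expectation p0 \<pi> P 0 (\<lambda>x. V (fst x)) = (\<Sum>s\<in>UNIV. pmf p0 s * V s)"
  unfolding pair_expectation_def expectation_history_Suc
  by (simp add: step_pmf_Nil expectation_state_component)

text \<open>Condition on the history up to period \<open>t\<close>: the next state is drawn from the
  kernel row of the last pair, and the action chosen afterwards does not affect a function of the
  state.\<close>

lemma pair_expectation_Suc_state:
  fixes p0 :: "'s::finite pmf" and \<pi> :: "('s, 'a::finite) policy"
  assumes "\<And>s a. prob_vector (P s a)"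
  shows "pair_expectation p0 \<pi> P (Suc t) (\<lambda>x. V (fst x)) =
    pair_expectation p0 \<pi> P t (\<lambda>(s, a). \<Sum>s'\<in>UNIV. P s a $ s' * V s')"
proof -
  have "measure_pmf.expectation (step_pmf p0 \<pi> P h) (\<lambda>x. V (fst (last (h @ [x])))) =
      (\<lambda>(s, a). \<Sum>s'\<in>UNIV. P s a $ s' * V s') (last h)" if "h \<noteq> []" for h
    using that
    by (cases h rule: rev_cases)
       (simp_all add: step_pmf_snoc expectation_state_component pmf_kernel_row assms split_beta)
  \<comment> \<open>The one-step formula refers to \<open>last h\<close>, so the empty history has
    to be excluded almost surely.\<close>
  moreover have "h \<noteq> []" if "h \<in> set_pmf (history_pmf (step_pmf p0 \<pi> P) (Suc t))" for h
    using length_history[OF that] by auto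
  ultimately show ?thesis
    unfolding pair_expectation_def
    by (subst expectation_history_Suc) (intro integral_cong_AE, auto simp: AE_measure_pmf_iff simp del: history_pmf.simps)
qed

text \<open>\<open>V\<close> is arbitrary, and the integrand is its one-step Bellman residual. The
  terms in \<open>V\<close> telescope, leaving the initial value because discounting kills the tail.
  A sign of the residual thus bounds the return of a history-dependent policy.\<close>

lemma performance_difference:
  fixes rew :: "'s::finite \<Rightarrow> 'a::finite \<Rightarrow> real" and V :: "'s \<Rightarrow> real"
  assumes l: "0 < l" "l < 1" and P: "\<And>s a. prob_vector (P s a)"
  shows "expected_return rew l p0 \<pi> P = (\<Sum>s\<in>UNIV. pmf p0 s * V s) +
    (\<Sum>t. l ^ t * pair_expectation p0 \<pi> P t
      (\<lambda>(s, a). rew s a + l * (\<Sum>s'\<in>UNIV. P s a $ s' * V s') - V s))"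
proof -
  let ?E = "pair_expectation p0 \<pi> P"
  let ?v = "\<lambda>t. ?E t (\<lambda>x. V (fst x))"
  let ?r = "\<lambda>(s, a). rew s a"
  let ?D = "\<lambda>(s, a). rew s a + l * (\<Sum>s'\<in>UNIV. P s a $ s' * V s') - V s"
  have E: "?E t ?D = ?E t ?r + l * ?v (Suc t) - ?v t" for t
  proof -
    have "?E t ?D = ?E t ?r + l * ?E t (\<lambda>(s, a). \<Sum>s'\<in>UNIV. P s a $ s' * V s') - ?v t"
      unfolding pair_expectation_def
      by (simp add: split_beta integrable_history del: history_pmf.simps)
    then show ?thesis
      by (simp only: pair_expectation_Suc_state[OF P, where V = V])
  qed
  have D: "l ^ t * ?E t ?D = l ^ t * ?E t ?r + (l ^ Suc t * ?v (Suc t) - l ^ t * ?v t)" for t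
    by (subst E) (simp add: algebra_simps)
  have "(\<lambda>t. l ^ t * ?v t) \<longlonglongrightarrow> 0"
    by (rule summable_LIMSEQ_zero) (rule summable_discounted_pair_expectation[OF l])
  then have "(\<lambda>t. l ^ Suc t * ?v (Suc t) - l ^ t * ?v t) sums (0 - l ^ 0 * ?v 0)"
    by (rule telescope_sums)
  from sums_add[OF summable_sums[OF summable_discounted_pair_expectation[OF l, of p0 \<pi> P ?r]] this]
  have "(\<Sum>t. l ^ t * ?E t ?D) = (\<Sum>t. l ^ t * ?E t ?r) - ?v 0"
    unfolding D by (simp add: sums_iff)
  then show ?thesis
    by (simp add: expected_return_eq_suminf[OF l] pair_expectation_0_state)
qed

lemma set_step_pmf:
  "(s, a) \<in> set_pmf (step_pmf p0 \<pi> P h) \<Longrightarrow> a \<in> set_pmf (\<pi> (map (nth h) [0..<length h]) s)"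
  by (auto simp: step_pmf_def next_pair_def)

text \<open>Only actions in the support of the policy occur, so \<open>g\<close> is constrained only
  there. For a deterministic policy this means only at the chosen action.\<close>

lemma pair_expectation_nonneg:
  fixes P :: "('s::finite, 'a) kernel"
  assumes "\<And>h s a. a \<in> set_pmf (\<pi> h s) \<Longrightarrow> 0 \<le> g (s, a)"
  shows "0 \<le> pair_expectation p0 \<pi> P t g"
proof -
  have "0 \<le> g (last h)" if h: "h \<in> set_pmf (history_pmf (step_pmf p0 \<pi> P) (Suc t))" for h
    using h assms by (fastforce dest: set_step_pmf)
  then show ?thesis
    unfolding pair_expectation_def
    by (intro integral_nonneg_AE) (simp add: AE_measure_pmf_iff del: history_pmf.simps)
qed

lemma expected_return_le:
  fixes rew :: "'s::finite \<Rightarrow> 'a::finite \<Rightarrow> real" and V :: "'s \<Rightarrow> real"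
  assumes l: "0 < l" "l < 1" and P: "\<And>s a. prob_vector (P s a)"
    and V: "\<And>s a. rew s a + l * (\<Sum>s'\<in>UNIV. P s a $ s' * V s') \<le> V s"
  shows "expected_return rew l p0 \<pi> P \<le> (\<Sum>s\<in>UNIV. pmf p0 s * V s)"
proof -
  let ?D = "\<lambda>(s, a). rew s a + l * (\<Sum>s'\<in>UNIV. P s a $ s' * V s') - V s"
  have "0 \<le> pair_expectation p0 \<pi> P t (\<lambda>x. - ?D x)" for t
    using V by (intro pair_expectation_nonneg) (simp add: algebra_simps)
  then have "pair_expectation p0 \<pi> P t ?D \<le> 0" for t
    by (simp add: pair_expectation_def del: history_pmf.simps)
  then have "(\<Sum>t. l ^ t * pair_expectation p0 \<pi> P t ?D) \<le> (\<Sum>t. 0)"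
    using l by (intro suminf_le summable_discounted_pair_expectation) (auto simp: mult_nonneg_nonpos)
  then show ?thesis
    by (subst performance_difference[OF l P, where V = V]) simp
qed

lemma expected_return_ge:
  fixes rew :: "'s::finite \<Rightarrow> 'a::finite \<Rightarrow> real" and V :: "'s \<Rightarrow> real"
  assumes l: "0 < l" "l < 1" and P: "\<And>s a. prob_vector (P s a)"
    and V: "\<And>h s a. a \<in> set_pmf (\<pi> h s) \<Longrightarrow> V s \<le> rew s a + l * (\<Sum>s'\<in>UNIV. P s a $ s' * V s')"
  shows "(\<Sum>s\<in>UNIV. pmf p0 s * V s) \<le> expected_return rew l p0 \<pi> P"
proof -
  let ?D = "\<lambda>(s, a). rew s a + l * (\<Sum>s'\<in>UNIV. P s a $ s' * V s') - V s"
  have "0 \<le> pair_expectation p0 \<pi> P t ?D" for t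
    using V by (intro pair_expectation_nonneg) auto
  then have "0 \<le> (\<Sum>t. l ^ t * pair_expectation p0 \<pi> P t ?D)"
    using l by (intro suminf_nonneg summable_discounted_pair_expectation) auto
  then show ?thesis
    by (subst performance_difference[OF l P, where V = V]) simp
qed

section \<open>Continuity of the return in a parameter of the kernel\<close>

lemma pmf_bind_Pair:
  "pmf (bind_pmf q (\<lambda>s. map_pmf (Pair s) (k s))) (s, a) = pmf q s * pmf (k s) a"
proof -
  have "pmf (map_pmf (Pair s') (k s')) (s, a) = pmf (k s) a * indicator {s} s'" for s'
  proof (cases "s' = s")
    case True
    then show ?thesis using pmf_map_inj'[of "Pair s" "k s" a] by (simp add: inj_on_def)
  next
    case False
    then show ?thesis by (auto simp: pmf_eq_0_set_pmf)
  qed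
  then show ?thesis by (simp add: pmf_bind measure_pmf_single)
qed

context
  fixes S :: "'w::topological_space set" and P :: "'w \<Rightarrow> ('s::finite, 'a::finite) kernel"
  assumes cont: "\<And>s a s'. continuous_on S (\<lambda>w. P w s a $ s')"
    and prob: "\<And>w s a. w \<in> S \<Longrightarrow> prob_vector (P w s a)"
begin

text \<open>The parameter enters only through the kernel row of the last pair, and not at all for
  the empty history. \<open>embed_pmf\<close> reproduces that row because it is a probability vector
  on \<open>S\<close>.\<close>

lemma continuous_on_pmf_step: "continuous_on S (\<lambda>w. pmf (step_pmf p0 \<pi> (P w) h) x)"
proof (cases x)
  case (Pair s a)
  show ?thesis
  proof (cases h rule: rev_cases)
    case Nil
    then show ?thesis by (simp add: step_pmf_Nil)
  next
    case (snoc k y)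
    have "continuous_on S (\<lambda>w. P w (fst y) (snd y) $ s * pmf (\<pi> h s) a)"
      by (intro continuous_intros cont)
    then show ?thesis
      by (rule continuous_on_eq) (simp add: snoc Pair step_pmf_snoc pmf_bind_Pair pmf_kernel_row prob)
  qed
qed

lemma continuous_on_pmf_history:
  "continuous_on S (\<lambda>w. pmf (history_pmf (step_pmf p0 \<pi> (P w)) (length h)) h)"
proof (induction h rule: rev_induct)
  case Nil
  then show ?case by simp
next
  case (snoc x h)
  then show ?case
    unfolding length_append_singleton pmf_history_snoc
    by (intro continuous_on_mult continuous_on_pmf_step)
qed

lemma continuous_on_pair_expectation: "continuous_on S (\<lambda>w. pair_expectation p0 \<pi> (P w) t g)"
proof -
  \<comment> \<open>The support of the history law may vary with \<open>w\<close>, so the sum runs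
    over all lists of the right length, a fixed finite set.\<close>
  let ?H = "{h :: ('s \<times> 'a) list. length h = Suc t}"
  have fin: "finite ?H"
    using finite_lists_length_eq[of "UNIV :: ('s \<times> 'a) set" "Suc t"] by simp
  have "pair_expectation p0 \<pi> (P w) t g =
      (\<Sum>h\<in>?H. g (last h) * pmf (history_pmf (step_pmf p0 \<pi> (P w)) (length h)) h)" for w
  proof -
    have "pair_expectation p0 \<pi> (P w) t g =
        (\<Sum>h\<in>?H. g (last h) * pmf (history_pmf (step_pmf p0 \<pi> (P w)) (Suc t)) h)"
      unfolding pair_expectation_def
      by (rule integral_measure_pmf_real[OF fin]) (simp add: length_history del: history_pmf.simps)
    then show ?thesis by simp
  qed
  then show ?thesis
    by (simp only:) (intro continuous_intros continuous_on_pmf_history)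
qed

text \<open>Every partial sum is continuous, and by the Weierstrass M-test with a geometric majorant
  the convergence is uniform in the parameter.\<close>

lemma continuous_on_expected_return:
  assumes l: "0 < l" "l < 1"
  shows "continuous_on S (\<lambda>w. expected_return rew l p0 \<pi> (P w))"
proof -
  let ?g = "\<lambda>(s, a). rew s a"
  let ?E = "\<lambda>w t. l ^ t * pair_expectation p0 \<pi> (P w) t ?g"
  have "uniform_limit S (\<lambda>n w. \<Sum>t<n. ?E w t) (\<lambda>w. \<Sum>t. ?E w t) sequentially"
  proof (rule Weierstrass_m_test)
    show "norm (?E w t) \<le> l ^ t * (MAX x. \<bar>?g x\<bar>)" for w t
      using l abs_pair_expectation_le[of p0 \<pi> "P w" t ?g] by (simp add: abs_mult)
    show "summable (\<lambda>t. l ^ t * (MAX x. \<bar>?g x\<bar>))"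
      using l by (intro summable_mult2 summable_geometric) auto
  qed
  then have "continuous_on S (\<lambda>w. \<Sum>t. ?E w t)"
    by (rule uniform_limit_theorem[rotated])
      (auto intro!: always_eventually continuous_intros continuous_on_pair_expectation)
  then show ?thesis
    by (simp add: expected_return_eq_suminf[OF l])
qed

end

section \<open>A Knaster-Tarski fixed point in an order interval of real functions\<close>

lemma interval_fixpoint:
  fixes T :: "('s \<Rightarrow> real) \<Rightarrow> 's \<Rightarrow> real"
  assumes mono: "\<And>v w. v \<le> w \<Longrightarrow> T v \<le> T w"
    and ab: "a \<le> b" "a \<le> T a" "T b \<le> b"
  obtains v where "T v = v"
proof
  \<comment> \<open>The candidate is the pointwise supremum of the post-fixed points below
    \<open>b\<close>. The upper bound \<open>b\<close> makes these real suprema meaningful, and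
    \<open>a\<close> shows that there is something to take the supremum of.\<close>
  define A where "A = {v. v \<le> b \<and> v \<le> T v}"
  define V where "V s = (SUP v\<in>A. v s)" for s
  have bdd: "bdd_above ((\<lambda>v. v s) ` A)" for s
    by (rule bdd_aboveI2[where M = "b s"]) (auto simp: A_def le_fun_def)
  have ne: "A \<noteq> {}" using ab by (auto simp: A_def)
  have upper: "v \<le> V" if "v \<in> A" for v
    unfolding V_def by (rule le_funI) (rule cSUP_upper[OF that bdd])
  have least: "V \<le> w" if "\<And>v. v \<in> A \<Longrightarrow> v \<le> w" for w
    unfolding V_def using that by (intro le_funI cSUP_least[OF ne]) (auto simp: le_fun_def)
  have Vb: "V \<le> b" by (rule least) (simp add: A_def)
  have VT: "V \<le> T V"
  proof (rule least)
    fix v assume v: "v \<in> A"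
    then have "v \<le> T v" by (simp add: A_def)
    also have "\<dots> \<le> T V" by (rule mono[OF upper[OF v]])
    finally show "v \<le> T V" .
  qed
  have "T V \<in> A"
    using mono[OF VT] order_trans[OF mono[OF Vb] ab(3)] by (simp add: A_def)
  from upper[OF this] VT show "T V = V" by simp
qed

section \<open>Mixture kernels, the inner minimum and the robust Bellman equation\<close>

definition mixture ::
  "('r::finite \<Rightarrow> 's::finite \<Rightarrow> 'a \<Rightarrow> real) \<Rightarrow> ('r \<Rightarrow> real ^ 's) \<Rightarrow> ('s, 'a) kernel"
where "mixture u w = (\<lambda>s a. \<chi> s'. \<Sum>i\<in>UNIV. u i s a * w i $ s')"

text \<open>Extensionality is vacuous on \<open>UNIV\<close>, so the choices of factors form a
  product \<open>PiE\<close>, to which compactness of products applies.\<close>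

lemma uncertainty_set_eq_mixture_image:
  "uncertainty_set u W = mixture u ` (\<Pi>\<^sub>E i\<in>UNIV. W i)"
  by (auto simp: uncertainty_set_def mixture_def PiE_iff)

text \<open>This is where the rectangular structure enters: the expected next value is a weighted
  sum of factor values \<open>w i\<close> against \<open>v\<close>, which are the same for all
  states and actions. With nonnegative weights, one choice of minimising factors is worst for all
  pairs at once.\<close>

lemma sum_mixture:
  "(\<Sum>s'\<in>UNIV. mixture u w s a $ s' * v s') = (\<Sum>i\<in>UNIV. u i s a * (\<Sum>s'\<in>UNIV. w i $ s' * v s'))"
  unfolding mixture_def
  by (simp add: sum_distrib_left sum_distrib_right mult.assoc) (rule sum.swap)

lemma prob_vector_mixture:
  assumes "r_rectangular_data u W" "\<And>i. w i \<in> W i"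
  shows "prob_vector (mixture u w s a)"
proof -
  have w: "prob_vector (w i)" for i
    using assms unfolding r_rectangular_data_def by blast
  then have "(\<Sum>s'\<in>UNIV. mixture u w s a $ s') = 1"
    using assms(1) sum_mixture[of u w s a "\<lambda>_. 1"] by (simp add: r_rectangular_data_def prob_vector_def)
  moreover have "0 \<le> mixture u w s a $ s'" for s'
    using assms(1) w by (auto simp: mixture_def r_rectangular_data_def prob_vector_def intro!: sum_nonneg)
  ultimately show ?thesis by (simp add: prob_vector_def)
qed

text \<open>The product of the compact factor sets is compact and the return is continuous on it,
  whatever the policy remembers.\<close>

lemma expected_return_attains_min:
  fixes rew :: "'s::finite \<Rightarrow> 'a::finite \<Rightarrow> real" and W :: "'r::finite \<Rightarrow> (real ^ 's) set"
  assumes l: "0 < l" "l < 1" and u: "r_rectangular_data u W"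
    and W: "\<And>i. compact (W i)" "\<And>i. W i \<noteq> {}"
  shows "\<exists>P. is_arg_min (expected_return rew l p0 \<pi>) (\<lambda>Q. Q \<in> uncertainty_set u W) P"
proof -
  let ?S = "\<Pi>\<^sub>E i\<in>UNIV. W i"
  let ?R = "\<lambda>w. expected_return rew l p0 \<pi> (mixture u w)"
  have "compactin (product_topology (\<lambda>i. euclidean) UNIV) ?S"
    using W by (simp add: compactin_PiE)
  then have compact: "compact ?S"
    by (simp add: euclidean_product_topology)
  have "continuous_on ?S (\<lambda>w. w i)" for i
    by (rule continuous_on_subset[OF continuous_on_product_coordinates]) simp
  then have "continuous_on ?S (\<lambda>w. mixture u w s a $ s')" for s a s'
    unfolding mixture_def by (simp del: PiE_UNIV_domain) (intro continuous_intros)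
  then have "continuous_on ?S ?R"
    using l u by (intro continuous_on_expected_return prob_vector_mixture) (auto simp: PiE_iff)
  moreover have "?S \<noteq> {}" using W by (simp add: PiE_eq_empty_iff del: PiE_UNIV_domain)
  ultimately have "\<exists>w\<in>?S. \<forall>w'\<in>?S. ?R w \<le> ?R w'"
    by (intro continuous_attains_inf compact)
  then obtain w where "w \<in> ?S" "\<forall>w'\<in>?S. ?R w \<le> ?R w'" ..
  then have "is_arg_min (expected_return rew l p0 \<pi>) (\<lambda>Q. Q \<in> uncertainty_set u W) (mixture u w)"
    unfolding uncertainty_set_eq_mixture_image is_arg_min_linorder by blast
  then show ?thesis by blast
qed

text \<open>The robust Bellman operator \<open>T\<close> is monotone and maps an order interval into
  itself, so it has a fixed point \<open>v\<close>. The factors minimising against \<open>v\<close>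
  make every action at most \<open>v\<close>, since \<open>T\<close> takes the maximum over actions.
  The maximising rule \<open>d\<close> guarantees \<open>v\<close> against all factors, since
  \<open>Q\<close> already takes the worst ones.\<close>

lemma robust_Bellman_solution:
  fixes rew :: "'s::finite \<Rightarrow> 'a::finite \<Rightarrow> real" and W :: "'r::finite \<Rightarrow> (real ^ 's) set"
  assumes rew: "\<And>s a. 0 \<le> rew s a"
    and l: "0 < l" "l < 1" and u: "r_rectangular_data u W"
    and W: "\<And>i. compact (W i)" "\<And>i. W i \<noteq> {}"
  obtains w v d where "\<And>i. w i \<in> W i"
    and "\<And>s a. rew s a + l * (\<Sum>s'\<in>UNIV. mixture u w s a $ s' * v s') \<le> v s"
    and "\<And>s w'. \<forall>i. w' i \<in> W i \<Longrightarrow>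
      v s \<le> rew s (d s) + l * (\<Sum>s'\<in>UNIV. mixture u w' s (d s) $ s' * v s')"
proof -
  define is_min where "is_min v i w \<longleftrightarrow>
      w \<in> W i \<and> (\<forall>w'\<in>W i. (\<Sum>s\<in>UNIV. w $ s * v s) \<le> (\<Sum>s\<in>UNIV. w' $ s * v s))" for v i w
  define m where "m v i = (SOME w. is_min v i w)" for v i
  have "is_min v i (m v i)" for v i
  proof -
    have "\<exists>w\<in>W i. \<forall>w'\<in>W i. (\<Sum>s\<in>UNIV. w $ s * v s) \<le> (\<Sum>s\<in>UNIV. w' $ s * v s)"
      by (rule continuous_attains_inf[OF W]) (intro continuous_intros)
    then have "\<exists>w. is_min v i w"
      unfolding is_min_def by blast
    then show ?thesis
      unfolding m_def by (rule someI_ex)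
  qed
  then have m: "m v i \<in> W i"
    and m_le: "w \<in> W i \<Longrightarrow> (\<Sum>s\<in>UNIV. m v i $ s * v s) \<le> (\<Sum>s\<in>UNIV. w $ s * v s)" for v i w
    by (auto simp: is_min_def)
  have u0: "0 \<le> u i s a" and u1: "(\<Sum>i\<in>UNIV. u i s a) = 1" for i s a
    using u by (auto simp: r_rectangular_data_def)
  have m0: "0 \<le> m v i $ s" and m1: "(\<Sum>s\<in>UNIV. m v i $ s) = 1" for v i s
    using m[of v i] u by (auto simp: r_rectangular_data_def prob_vector_def)
  define Q where "Q v s a = rew s a + l * (\<Sum>i\<in>UNIV. u i s a * (\<Sum>s'\<in>UNIV. m v i $ s' * v s'))"
    for v s a
  define T where "T v s = (MAX a. Q v s a)" for v s
  have Q_mono: "Q v s a \<le> Q w s a" if "v \<le> w" for v w s a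
  proof -
    have value_mono: "(\<Sum>s'\<in>UNIV. m v i $ s' * v s') \<le> (\<Sum>s'\<in>UNIV. m w i $ s' * w s')" for i
    proof -
      \<comment> \<open>First replace the minimiser for \<open>v\<close> by the one for
        \<open>w\<close>, which is feasible but possibly worse for \<open>v\<close>. Only then raise
        \<open>v\<close> to \<open>w\<close>.\<close>
      have "(\<Sum>s'\<in>UNIV. m v i $ s' * v s') \<le> (\<Sum>s'\<in>UNIV. m w i $ s' * v s')"
        by (rule m_le[OF m])
      also have "\<dots> \<le> (\<Sum>s'\<in>UNIV. m w i $ s' * w s')"
        using that m0 by (intro sum_mono mult_left_mono) (auto simp: le_fun_def)
      finally show ?thesis .
    qed
    show ?thesis
      unfolding Q_def
      by (rule add_left_mono, rule mult_left_mono, rule sum_mono, rule mult_left_mono)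
        (use l u0 value_mono in auto)
  qed
  have Q_le_T: "Q v s a \<le> T v s" for v s a
    unfolding T_def by (rule Max_ge) auto
  have T_eq: "\<exists>a. T v s = Q v s a" for v s
  proof -
    have "T v s \<in> range (Q v s)"
      unfolding T_def by (rule Max_in) auto
    then show ?thesis by blast
  qed
  \<comment> \<open>A constant passes through the operator unchanged except for discounting, as the
    factors and the weights both sum to 1.\<close>
  have Q_const: "Q (\<lambda>_. c) s a = rew s a + l * c" for c s a
    by (simp add: Q_def sum_distrib_right[symmetric] m1 u1)
  define B where "B = (MAX x. \<bar>case_prod rew x\<bar>)"
  have B: "rew s a \<le> B" for s a
    using abs_le_Max[of "case_prod rew" "(s, a)"] by (simp add: B_def)
  have B0: "0 \<le> B"
    using rew B order_trans by blast
  \<comment> \<open>\<open>b\<close> is the return of earning the largest reward \<open>B\<close>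
    forever. It solves \<open>B + l * b = b\<close>, so \<open>T\<close> maps the constant
    \<open>b\<close> below itself.\<close>
  define b where "b = B / (1 - l)"
  have b: "B + l * b = b"
    using l by (simp add: b_def field_simps)
  obtain v where v: "T v = v"
  proof (rule interval_fixpoint[of T "\<lambda>_. 0" "\<lambda>_. b"])
    show "T v \<le> T w" if "v \<le> w" for v w
    proof (rule le_funI)
      fix s
      obtain a where "T v s = Q v s a" using T_eq by blast
      then show "T v s \<le> T w s"
        using Q_mono[OF that, of s a] Q_le_T[of w s a] by simp
    qed
    show "(\<lambda>_. 0) \<le> (\<lambda>_. b)"
      using l B0 by (simp add: b_def le_fun_def)
    show "(\<lambda>_. 0) \<le> T (\<lambda>_. 0)"
    proof (rule le_funI)
      fix s
      obtain a where "T (\<lambda>_. 0) s = Q (\<lambda>_. 0) s a" using T_eq by blast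
      then show "0 \<le> T (\<lambda>_. 0) s" using rew[of s a] by (simp add: Q_const)
    qed
    show "T (\<lambda>_. b) \<le> (\<lambda>_. b)"
    proof (rule le_funI)
      fix s
      obtain a where "T (\<lambda>_. b) s = Q (\<lambda>_. b) s a" using T_eq by blast
      then show "T (\<lambda>_. b) s \<le> b" using B[of s a] b by (simp add: Q_const)
    qed
  qed
  obtain d where d: "\<And>s. T v s = Q v s (d s)"
    using T_eq by metis
  show thesis
  proof
    show "m v i \<in> W i" for i by (rule m)
    show "rew s a + l * (\<Sum>s'\<in>UNIV. mixture u (m v) s a $ s' * v s') \<le> v s" for s a
      using Q_le_T[of v s a] unfolding v by (simp add: Q_def sum_mixture)
    show "v s \<le> rew s (d s) + l * (\<Sum>s'\<in>UNIV. mixture u w' s (d s) $ s' * v s')"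
      if w': "\<forall>i. w' i \<in> W i" for s w'
    proof -
      have "Q v s (d s) \<le> rew s (d s) + l * (\<Sum>s'\<in>UNIV. mixture u w' s (d s) $ s' * v s')"
        unfolding Q_def sum_mixture
        by (rule add_left_mono, rule mult_left_mono, rule sum_mono, rule mult_left_mono)
          (use l u0 m_le w' in auto)
      then show ?thesis using d[of s] by (simp add: v)
    qed
  qed
qed

section \<open>The saddle point of greedy rule and worst-case factors\<close>

theorem proposition2p5:
  fixes rew :: "'s::finite \<Rightarrow> 'a::finite \<Rightarrow> real"
    and l :: real
    and p0 :: "'s pmf"
    and u :: "'r::finite \<Rightarrow> 's \<Rightarrow> 'a \<Rightarrow> real"
    and W :: "'r \<Rightarrow> (real ^ 's) set"
    and complexity :: "(real ^ 's) set \<Rightarrow> real"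
  assumes "\<And>s a. 0 \<le> rew s a"
    and "0 < l" and "l < 1"
    and "r_rectangular_data u W"
    and "\<And>i. tractable complexity (W i)"
  shows "\<exists>\<pi>. stationary \<pi> \<and>
    solves_max_min (expected_return rew l p0) UNIV (uncertainty_set u W) \<pi>"
proof -
  have W: "\<And>i. compact (W i)" "\<And>i. W i \<noteq> {}"
    using assms(5) by (auto simp: tractable_def)
  obtain w v d where w: "\<And>i. w i \<in> W i"
    and v_ge: "\<And>s a. rew s a + l * (\<Sum>s'\<in>UNIV. mixture u w s a $ s' * v s') \<le> v s"
    and v_le: "\<And>s w'. \<forall>i. w' i \<in> W i \<Longrightarrow>
      v s \<le> rew s (d s) + l * (\<Sum>s'\<in>UNIV. mixture u w' s (d s) $ s' * v s')"
    by (rule robust_Bellman_solution[of rew, OF assms(1-4) W]) (rule that)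
  define \<pi> :: "('s, 'a) policy" where "\<pi> = (\<lambda>_ s. return_pmf (d s))"
  let ?R = "expected_return rew l p0" and ?K = "uncertainty_set u W"
  let ?v = "\<Sum>s\<in>UNIV. pmf p0 s * v s"
  have "mixture u w \<in> ?K"
    using w by (auto simp: uncertainty_set_eq_mixture_image)
  have upper: "?R \<pi>' (mixture u w) \<le> ?v" for \<pi>'
    by (rule expected_return_le[OF assms(2,3) prob_vector_mixture[OF assms(4) w] v_ge])
  \<comment> \<open>The support of the policy is the single action \<open>d s\<close>, the only one
    for which \<open>v_le\<close> gives the Bellman inequality.\<close>
  have lower: "?v \<le> ?R \<pi> P" if K: "P \<in> ?K" for P
  proof -
    obtain w' where P: "P = mixture u w'" and w': "\<And>i. w' i \<in> W i"
      using K by (auto simp: uncertainty_set_eq_mixture_image)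
    show ?thesis
      unfolding P
      by (rule expected_return_ge[OF assms(2,3) prob_vector_mixture[OF assms(4) w']])
        (use v_le w' in \<open>auto simp: \<pi>_def\<close>)
  qed
  note attained = expected_return_attains_min[OF assms(2-4) W, of rew p0]
  obtain P where P: "is_arg_min (?R \<pi>) (\<lambda>Q. Q \<in> ?K) P"
    using attained by blast
  \<comment> \<open>The saddle value \<open>?v\<close> separates the two worst cases: any policy
    does no better at its own minimiser than at \<open>mixture u w\<close>, hence at most
    \<open>?v\<close>, while \<open>\<pi>\<close> earns at least \<open>?v\<close> at
    \<open>P\<close>.\<close>
  have "\<exists>P'. is_arg_min (?R \<pi>') (\<lambda>Q. Q \<in> ?K) P' \<and> ?R \<pi>' P' \<le> ?R \<pi> P" for \<pi>'
  proof -
    obtain P' where P': "is_arg_min (?R \<pi>') (\<lambda>Q. Q \<in> ?K) P'"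
      using attained by blast
    then have "?R \<pi>' P' \<le> ?R \<pi>' (mixture u w)"
      using \<open>mixture u w \<in> ?K\<close> by (simp add: is_arg_min_linorder)
    also have "\<dots> \<le> ?v" by (rule upper)
    also have "\<dots> \<le> ?R \<pi> P"
      using P by (intro lower) (simp add: is_arg_min_linorder)
    finally show ?thesis using P' by blast
  qed
  with P have "solves_max_min ?R UNIV ?K \<pi>"
    unfolding solves_max_min_def by blast
  moreover have "stationary \<pi>"
    by (auto simp: stationary_def \<pi>_def)
  ultimately show ?thesis by blast
qed

end
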